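(* Let $V$ be a vector space over a field $F$, and let $S$ and $T$ be sets. If $f_S : F_0^S \to V$ is a linear isomorphism and $f_T : F_0^T \to V$ is a linear isomorphism, then $|S| = |T|$.
   Context: For a field $F$ and a set $S$, $F_0^S$ denotes the $F$-vector space of all functions $S \to F$ with finite support. For $S=\emptyset$, $F_0^S=\{\mathbf 0\}$. $|S|$ denotes the cardinality of $S$ (sets may be infinite). *)

theory Defs
  imports Complex_Main "HOL-Library.Function_Algebras"
begin

unbundle cardinal_syntax

(* A function S -> F is encoded as a total function on the ambient type that vanishes outside S;
   since the support is already required to be a subset of S, this loses nothing. *)
definition finsupp :: "'s set \<Rightarrow> ('s \<Rightarrow> 'f::zero) set" where
  "finsupp S = {a. {s. a s \<noteq> 0} \<subseteq> S \<and> finite {s. a s \<noteq> 0}}"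

definition fun_scale :: "'f::times \<Rightarrow> ('s \<Rightarrow> 'f) \<Rightarrow> ('s \<Rightarrow> 'f)" where
  "fun_scale c a = (\<lambda>s. c * a s)"

(* Only the values of f on A matter; meant for subspaces A and B of the ambient spaces
   with scalar multiplications scaleA and scaleB. *)
definition linear_iso_on ::
  "('f \<Rightarrow> 'a \<Rightarrow> 'a) \<Rightarrow> ('f \<Rightarrow> 'b \<Rightarrow> 'b) \<Rightarrow> 'a::plus set \<Rightarrow> 'b::plus set \<Rightarrow> ('a \<Rightarrow> 'b) \<Rightarrow> bool" where
  "linear_iso_on scaleA scaleB A B f \<longleftrightarrow>
     (\<forall>x\<in>A. \<forall>y\<in>A. f (x + y) = f x + f y) \<and>
     (\<forall>c. \<forall>x\<in>A. f (scaleA c x) = scaleB c (f x)) \<and>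
     bij_betw f A B"

lemma vector_space_fun_scale:
  "vector_space (fun_scale :: 'f::field \<Rightarrow> ('s \<Rightarrow> 'f) \<Rightarrow> 's \<Rightarrow> 'f)"
  by unfold_locales (auto simp: fun_scale_def fun_eq_iff algebra_simps)

lemma subspace_finsupp:
  "module.subspace (fun_scale :: 'f::field \<Rightarrow> ('s \<Rightarrow> 'f) \<Rightarrow> 's \<Rightarrow> 'f) (finsupp S)"
proof -
  interpret vector_space "fun_scale :: 'f \<Rightarrow> ('s \<Rightarrow> 'f) \<Rightarrow> 's \<Rightarrow> 'f"
    by (rule vector_space_fun_scale)
  show ?thesis
  proof (rule subspaceI)
    fix a b :: "'s \<Rightarrow> 'f" assume *: "a \<in> finsupp S" "b \<in> finsupp S"
    have "{s. (a + b) s \<noteq> 0} \<subseteq> {s. a s \<noteq> 0} \<union> {s. b s \<noteq> 0}" by auto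
    with * show "a + b \<in> finsupp S"
      unfolding finsupp_def by (blast intro: finite_subset finite_UnI)
  qed (auto simp: finsupp_def fun_scale_def)
qed

lemma finsupp_empty: "finsupp {} = {0}"
  by (auto simp: finsupp_def fun_eq_iff)

end

(* The images of the indicator functions of the points of S form a basis of V, indexed injectively
   by S; any two bases of V have the same cardinality. *)
theory Submission
  imports Defs "HOL-Library.Indicator_Function"
begin

text \<open>Finitely supported functions on S have the indicators of single points as a basis, and a
  linear isomorphism carries a basis to a basis. Hence the vectors \<open>f (indicator {s})\<close>
  with s in S are pairwise distinct (\<open>inj_on_linear_iso_indicator\<close>), span V by
  surjectivity of f (\<open>span_linear_iso_indicator\<close>) and are independent by injectivity
  (\<open>independent_linear_iso_indicator\<close>). Taken for S and for T, this gives two bases of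
  V, which are equipotent even when infinite. The context treats one index set, so that it can be
  used for both.\<close>

context
  fixes scale :: "'f::field \<Rightarrow> 'v::ab_group_add \<Rightarrow> 'v"
    and S :: "'s set" and f :: "('s \<Rightarrow> 'f) \<Rightarrow> 'v"
  assumes V: "vector_space scale"
    and iso: "linear_iso_on fun_scale scale (finsupp S) UNIV f"
begin

interpretation vector_space scale by (rule V)

lemma linear_iso_finsupp_add: "x \<in> finsupp S \<Longrightarrow> y \<in> finsupp S \<Longrightarrow> f (x + y) = f x + f y"
  and linear_iso_finsupp_scale: "x \<in> finsupp S \<Longrightarrow> f (fun_scale c x) = scale c (f x)"
  and linear_iso_finsupp_bij: "bij_betw f (finsupp S) UNIV"
  using iso by (auto simp: linear_iso_on_def)

lemma linear_iso_finsupp_zero: "f 0 = 0"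
  using linear_iso_finsupp_add[of 0 0] by (simp add: finsupp_def)

text \<open>Additivity is available only for two arguments in \<open>finsupp S\<close>, so points
  are peeled off A one at a time; \<open>A \<subseteq> S\<close> keeps every summand there.\<close>

lemma linear_iso_finsupp_sum:
  assumes "finite A" "A \<subseteq> S"
  shows "f (\<lambda>s. if s \<in> A then c s else 0) = (\<Sum>s\<in>A. scale (c s) (f (indicator {s})))"
  using assms
proof (induction A rule: finite_induct)
  case empty
  then show ?case using linear_iso_finsupp_zero by (simp add: zero_fun_def)
next
  case (insert a A)
  let ?r = "\<lambda>s. if s \<in> A then c s else 0"
  have ind: "indicator {a} \<in> finsupp S"
    using insert.prems by (auto simp: finsupp_def indicator_def)
  have sc: "fun_scale (c a) (indicator {a}) \<in> finsupp S"
    using insert.prems by (auto simp: finsupp_def fun_scale_def indicator_def)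
  have r: "?r \<in> finsupp S"
    using insert.prems insert.hyps(1) by (auto simp: finsupp_def)
  have "(\<lambda>s. if s \<in> insert a A then c s else 0) = fun_scale (c a) (indicator {a}) + ?r"
    using insert.hyps(2) by (auto simp: fun_eq_iff fun_scale_def indicator_def)
  then show ?case
    using insert by (simp add: linear_iso_finsupp_add[OF sc r] linear_iso_finsupp_scale[OF ind])
qed

text \<open>Distinct points have distinct indicators because 1 \<noteq> 0 in a field, and f is
  injective on \<open>finsupp S\<close>.\<close>

lemma inj_on_linear_iso_indicator: "inj_on (\<lambda>s. f (indicator {s})) S"
proof (rule inj_onI)
  fix s t assume "s \<in> S" "t \<in> S" "f (indicator {s}) = f (indicator {t})"
  then have "(indicator {s} :: 's \<Rightarrow> 'f) = indicator {t}"
    by (intro inj_onD[OF bij_betw_imp_inj_on[OF linear_iso_finsupp_bij]])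
      (auto simp: finsupp_def indicator_def)
  from fun_cong[OF this, of s] show "s = t" by (simp add: indicator_def split: if_splits)
qed

lemma span_linear_iso_indicator: "span ((\<lambda>s. f (indicator {s})) ` S) = UNIV"
proof -
  have "v \<in> span ((\<lambda>s. f (indicator {s})) ` S)" for v
  proof -
    obtain a where a: "a \<in> finsupp S" "v = f a"
      using linear_iso_finsupp_bij unfolding bij_betw_def by auto
    \<comment> \<open>Cutting a off outside its own finite support changes nothing, but gives it the
      form that \<open>linear_iso_finsupp_sum\<close> expands.\<close>
    have "a = (\<lambda>s. if s \<in> {s. a s \<noteq> 0} then a s else 0)" by auto
    then have "v = (\<Sum>s | a s \<noteq> 0. scale (a s) (f (indicator {s})))"
      using linear_iso_finsupp_sum[of "{s. a s \<noteq> 0}" a] a by (simp add: finsupp_def)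
    also have "\<dots> \<in> span ((\<lambda>s. f (indicator {s})) ` S)"
      using a(1) by (intro span_sum span_scale span_base) (auto simp: finsupp_def)
    finally show ?thesis .
  qed
  then show ?thesis by blast
qed

text \<open>A linear relation among these vectors is the image under f of the function of its
  coefficients; as \<open>f 0 = 0\<close> and f is injective, that function is zero.\<close>

lemma independent_linear_iso_indicator: "independent ((\<lambda>s. f (indicator {s})) ` S)"
  unfolding independent_explicit_module
proof (intro allI impI)
  fix B u v
  assume B: "finite B" "B \<subseteq> (\<lambda>s. f (indicator {s})) ` S" "(\<Sum>v\<in>B. scale (u v) v) = 0" "v \<in> B"
  obtain A where A: "A \<subseteq> S" "B = (\<lambda>s. f (indicator {s})) ` A"
    using B(2) by (auto simp: subset_image_iff)
  have inj: "inj_on (\<lambda>s. f (indicator {s})) A"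
    using inj_on_linear_iso_indicator A(1) by (rule inj_on_subset)
  have finA: "finite A"
    using B(1) A(2) inj by (simp add: finite_image_iff)
  \<comment> \<open>The coefficients u are indexed by vectors; pulling them back to points loses
    nothing, since the indexing is injective on A.\<close>
  let ?a = "\<lambda>s. if s \<in> A then u (f (indicator {s})) else 0"
  have "f ?a = (\<Sum>v\<in>B. scale (u v) v)"
    by (simp add: linear_iso_finsupp_sum[OF finA A(1)] A(2) sum.reindex[OF inj])
  then have "f ?a = f 0"
    using B(3) linear_iso_finsupp_zero by simp
  then have "?a = 0"
    using finA A(1)
    by (intro inj_onD[OF bij_betw_imp_inj_on[OF linear_iso_finsupp_bij]])
      (auto simp: finsupp_def)
  then show "u v = 0"
    using B(4) A(2) by (auto simp: fun_eq_iff split: if_splits)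
qed

end

theorem corollary8p6:
  fixes scale :: "'f::field \<Rightarrow> 'v::ab_group_add \<Rightarrow> 'v"
    and S :: "'s set" and T :: "'t set"
    and f\<^sub>S :: "('s \<Rightarrow> 'f) \<Rightarrow> 'v" and f\<^sub>T :: "('t \<Rightarrow> 'f) \<Rightarrow> 'v"
  assumes "vector_space scale"
    and "linear_iso_on fun_scale scale (finsupp S) UNIV f\<^sub>S"
    and "linear_iso_on fun_scale scale (finsupp T) UNIV f\<^sub>T"
  shows "|S| =o |T|"
proof -
  interpret vector_space scale by fact
  let ?B = "(\<lambda>s. f\<^sub>S (indicator {s})) ` S" and ?C = "(\<lambda>t. f\<^sub>T (indicator {t})) ` T"
  \<comment> \<open>Two independent sets with the same span, here all of V, are in bijection,
    whether finite or infinite.\<close>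
  have "\<exists>h. bij_betw h ?B ?C"
    using assms by (intro bij_if_span_eq_span_bases)
      (simp_all add: independent_linear_iso_indicator span_linear_iso_indicator)
  then have "|?B| =o |?C|"
    by (simp add: card_of_ordIso)
  \<comment> \<open>Injectivity of the indexing makes each basis as large as its index set.\<close>
  moreover have "|S| =o |?B|" "|T| =o |?C|"
    using inj_on_linear_iso_indicator[OF assms(1,2)] inj_on_linear_iso_indicator[OF assms(1,3)]
    by (meson card_of_ordIso inj_on_imp_bij_betw)+
  ultimately show ?thesis
    by (meson ordIso_symmetric ordIso_transitive)
qed

end
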